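(* Let $A\in\mathbb{C}^{n\times n}$ be non-nilpotent with $\mathrm{ind}(A)=1$. Then: (1) $A^{\text{core}}=\lim\limits_{\lambda\to 0}AA^{*}\bigl(A^{2}A^{*}+\lambda I\bigr)^{-1}$; (2) $A_{\text{core}}=\lim\limits_{\lambda\to 0}\bigl(A^{*}A^{2}+\lambda I\bigr)^{-1}A^{*}A$, where $A^{\text{core}}$ is the core inverse of $A$ and $A_{\text{core}}$ is the dual core inverse of $A$.
   Context: $M^*$ is the conjugate transpose, $\mathrm{rk}(M)$ the rank, $R(M)$ the range (column space) of a complex matrix $M$, $P_M$ is the orthogonal projector onto $R(M)$, and $I$ is the identity matrix. The index $\mathrm{ind}(A)$ is the smallest nonnegative integer $k$ with $\mathrm{rk}(A^k)=\mathrm{rk}(A^{k+1})$. For $A\in\mathbb{C}^{n\times n}$ of index at most 1, the core inverse $A^{\text{core}}$ is the unique $X\in\mathbb{C}^{n\times n}$ with $AX=P_A$ and $R(X)\subseteq R(A)$; the dual core inverse $A_{\text{core}}$ is the unique $X\in\mathbb{C}^{n\times n}$ with $XA=P_{A^*}$ and $R(X)\subseteq R(A^* )$. Limits are taken as $\lambda\to0$ through nonzero complex scalars; for all sufficiently small $\lambda\ne 0$ the indicated inverses exist.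
   Formalization: The dual core inverse is taken as the unique X with XA = P_{A*}, R(X) ⊆ R(A* ) and also R(X* ) ⊆ R(A* ); the first two conditions alone do not determine X (for A = diag(1,0), any X with rows (1,t), (0,0) satisfies them). *)

theory Defs
  imports "HOL-Analysis.Analysis"
begin

definition ctranspose :: "complex^'n^'m \<Rightarrow> complex^'m^'n"
  where "ctranspose M = (\<chi> i j. cnj (M $ j $ i))"

definition mat_range :: "complex^'n^'m \<Rightarrow> (complex^'m) set"
  where "mat_range M = range ((*v) M)"

text \<open>The library instances of \<open>times\<close> and \<open>one\<close> on \<^type>\<open>vec\<close> are componentwise, so \<open>A ^ k\<close> would not
  be the power with respect to the matrix product.\<close>

primrec mat_pow :: "complex^'n^'n \<Rightarrow> nat \<Rightarrow> complex^'n^'n"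
  where
    "mat_pow A 0 = mat 1"
  | "mat_pow A (Suc k) = A ** mat_pow A k"

definition nilpotent_mat :: "complex^'n^'n \<Rightarrow> bool"
  where "nilpotent_mat A \<longleftrightarrow> (\<exists>k. mat_pow A k = 0)"

definition mat_ind :: "complex^'n^'n \<Rightarrow> nat"
  where "mat_ind A = (LEAST k. rank (mat_pow A k) = rank (mat_pow A (Suc k)))"

definition is_orth_projector :: "complex^'n^'n \<Rightarrow> (complex^'n) set \<Rightarrow> bool"
  where "is_orth_projector P S \<longleftrightarrow> P ** P = P \<and> ctranspose P = P \<and> mat_range P = S"

definition orth_projector :: "complex^'m^'n \<Rightarrow> complex^'n^'n"
  where "orth_projector M = (THE P. is_orth_projector P (mat_range M))"

text \<open>The core inverse and the dual core inverse are meaningful only for matrices of index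
  at most 1; otherwise the definite descriptions below need not denote anything.\<close>

definition is_core_inverse :: "complex^'n^'n \<Rightarrow> complex^'n^'n \<Rightarrow> bool"
  where "is_core_inverse A X \<longleftrightarrow>
    A ** X = orth_projector A \<and> mat_range X \<subseteq> mat_range A"

definition core_inverse :: "complex^'n^'n \<Rightarrow> complex^'n^'n"
  where "core_inverse A = (THE X. is_core_inverse A X)"

text \<open>In the literature the dual core inverse is often introduced by the first two conditions
  below alone, but these do not determine \<open>X\<close>: for \<open>A = diag(1, 0)\<close> every \<open>X\<close> with rows
  \<open>(1, t)\<close> and \<open>(0, 0)\<close> satisfies them. The third condition, a bound on the row space of \<open>X\<close>,
  restores uniqueness; with it, \<open>X\<close> is the dual core inverse of \<open>A\<close> iff \<open>X\<^sup>*\<close> is the core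
  inverse of \<open>A\<^sup>*\<close> (for \<open>A\<close> of index at most 1).\<close>

definition is_dual_core_inverse :: "complex^'n^'n \<Rightarrow> complex^'n^'n \<Rightarrow> bool"
  where "is_dual_core_inverse A X \<longleftrightarrow>
    X ** A = orth_projector (ctranspose A) \<and>
    mat_range X \<subseteq> mat_range (ctranspose A) \<and>
    mat_range (ctranspose X) \<subseteq> mat_range (ctranspose A)"

definition dual_core_inverse :: "complex^'n^'n \<Rightarrow> complex^'n^'n"
  where "dual_core_inverse A = (THE X. is_dual_core_inverse A X)"

end

theory Submission
  imports Defs
begin

text \<open>With \<open>T = A A\<^sup>*\<close>, \<open>P = P\<^sub>A\<close>, \<open>T\<^sup>+\<close> the Moore--Penrose inverse of \<open>T\<close> and \<open>X\<close> the core inverse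
  of \<open>A\<close>, the matrix \<open>B = A T\<close> satisfies \<open>B G = G B = P\<close> for \<open>G = T\<^sup>+ X\<close>. Hence
  \<open>(I + \<lambda> G) B = P (B + \<lambda> I)\<close>, so \<open>B (B + \<lambda> I)\<^sup>-\<^sup>1 = (I + \<lambda> G)\<^sup>-\<^sup>1 P\<close> tends to \<open>P\<close>; and since \<open>T = X B\<close>,
  \<open>T (B + \<lambda> I)\<^sup>-\<^sup>1 = X B (B + \<lambda> I)\<^sup>-\<^sup>1\<close> tends to \<open>X P = X\<close>. The dual statement is the conjugate
  transpose of this one for \<open>A\<^sup>*\<close>. Both \<open>X\<close> and \<open>T\<^sup>+\<close> come from group inverses, which exist
  for matrices of index at most 1, in particular for hermitian ones: \<open>X = A\<^sup># P\<close> and \<open>T\<^sup>+ = T\<^sup>#\<close>.\<close>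

section \<open>Matrix algebra\<close>

lemma matrix_add_rdistrib:
  fixes A B :: "'a::semiring_1^'n^'m"
  shows "(A + B) ** C = A ** C + B ** C"
  by (vector matrix_matrix_mult_def sum.distrib[symmetric] distrib_right)

lemma matrix_diff_ldistrib:
  fixes A :: "'a::ring_1^'n^'m"
  shows "A ** (B - C) = A ** B - A ** C"
  by (vector matrix_matrix_mult_def sum_subtractf[symmetric] right_diff_distrib)

lemma matrix_diff_rdistrib:
  fixes A B :: "'a::ring_1^'n^'m"
  shows "(A - B) ** C = A ** C - B ** C"
  by (vector matrix_matrix_mult_def sum_subtractf[symmetric] left_diff_distrib)

lemma mat_mult_commute:
  fixes M :: "'a::comm_semiring_1^'n^'n"
  shows "mat l ** M = M ** mat l"
  by (simp add: vec_eq_iff matrix_matrix_mult_def mat_def if_distrib if_distribR mult.commute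
      cong: if_cong)

lemma mat_mult_vector:
  fixes v :: "'a::semiring_1^'n"
  shows "mat l *v v = l *s v"
  by (simp add: vec_eq_iff matrix_vector_mult_def mat_def if_distrib if_distribR cong: if_cong)

lemma ctranspose_ctranspose [simp]: "ctranspose (ctranspose M) = M"
  by (simp add: ctranspose_def vec_eq_iff)

lemma ctranspose_mult: "ctranspose (M ** N) = ctranspose N ** ctranspose M"
  by (simp add: ctranspose_def vec_eq_iff matrix_matrix_mult_def mult.commute)

lemma ctranspose_add: "ctranspose (M + N) = ctranspose M + ctranspose N"
  by (simp add: ctranspose_def vec_eq_iff)

lemma ctranspose_diff: "ctranspose (M - N) = ctranspose M - ctranspose N"
  by (simp add: ctranspose_def vec_eq_iff)

lemma ctranspose_mat [simp]: "ctranspose (mat l) = mat (cnj l)"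
  by (simp add: ctranspose_def vec_eq_iff mat_def)

lemma ctranspose_eq_0_iff [simp]: "ctranspose M = 0 \<longleftrightarrow> M = 0"
  by (auto simp: ctranspose_def vec_eq_iff)

lemma tendsto_ctranspose:
  "(f \<longlongrightarrow> M) F \<Longrightarrow> ((\<lambda>x. ctranspose (f x)) \<longlongrightarrow> ctranspose M) F"
  unfolding ctranspose_def by (intro tendsto_intros)

text \<open>Each diagonal entry of \<open>M ** ctranspose M\<close> is the sum of the squared moduli
  of one row of \<open>M\<close>, and a sum of nonnegative reals vanishes only termwise.\<close>

lemma mult_ctranspose_eq_0:
  assumes "M ** ctranspose M = 0"
  shows "M = 0"
proof -
  have "M $ i $ j = 0" for i j
  proof -
    have "(\<Sum>k\<in>UNIV. M $ i $ k * cnj (M $ i $ k)) = 0"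
      using arg_cong[OF assms, of "\<lambda>N. N $ i $ i"]
      by (simp add: matrix_matrix_mult_def ctranspose_def)
    then have "of_real (\<Sum>k\<in>UNIV. (cmod (M $ i $ k))\<^sup>2) = (0::complex)"
      by (simp only: complex_norm_square[symmetric] of_real_sum)
    then have "(\<Sum>k\<in>UNIV. (cmod (M $ i $ k))\<^sup>2) = 0"
      using of_real_eq_0_iff by blast
    then show ?thesis
      by (simp add: sum_nonneg_eq_0_iff)
  qed
  then show ?thesis
    by (simp add: vec_eq_iff)
qed

text \<open>The squared length of \<open>T *v v\<close> is the inner product of \<open>v\<close>
  with \<open>T *v (T *v v)\<close>, because \<open>T\<close> is hermitian.\<close>

lemma hermitian_square_kernel:
  fixes T :: "complex^'n^'n"
  assumes "ctranspose T = T" and "T *v (T *v v) = 0"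
  shows "T *v v = 0"
proof -
  \<comment> \<open>\<open>V\<close> repeats \<open>v\<close> in every column. This turns the claim
    on vectors into one on matrices, so that \<open>mult_ctranspose_eq_0\<close> applies to
    \<open>ctranspose (T ** V)\<close>.\<close>
  define V :: "complex^'n^'n" where "V = (\<chi> i j. v $ i)"
  have col: "(M ** V) $ i $ j = (M *v v) $ i" for M :: "complex^'n^'n" and i j
    by (simp add: V_def matrix_matrix_mult_def matrix_vector_mult_def)
  have "(T ** T) ** V = 0"
    using assms(2) by (simp add: vec_eq_iff col matrix_vector_mul_assoc)
  then have "ctranspose (T ** V) ** ctranspose (ctranspose (T ** V)) = 0"
    by (simp add: ctranspose_mult assms(1) matrix_mul_assoc[symmetric])
  then have "ctranspose (T ** V) = 0"
    by (rule mult_ctranspose_eq_0)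
  then have "T ** V = 0"
    by simp
  then show ?thesis
    by (simp add: vec_eq_iff col)
qed

section \<open>Inverses of square matrices and conjugate transposition\<close>

lemma invertible_matrix_inv:
  assumes "invertible M"
  shows "M ** matrix_inv M = mat 1" and "matrix_inv M ** M = mat 1"
  using someI_ex[OF assms[unfolded invertible_def]] by (simp_all add: matrix_inv_def)

lemma matrix_inv_eqI:
  fixes M :: "'a::field^'n^'n"
  assumes "N ** M = mat 1"
  shows "matrix_inv M = N"
proof -
  have "invertible M"
    using assms invertible_left_inverse by blast
  then have "N ** M ** matrix_inv M = N"
    using invertible_matrix_inv(1)[of M] by (simp add: matrix_mul_assoc[symmetric])
  then show ?thesis
    by (simp add: assms)
qed

lemma ctranspose_matrix_inv:
  fixes M :: "complex^'n^'n"
  assumes "invertible M"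
  shows "matrix_inv (ctranspose M) = ctranspose (matrix_inv M)"
  using arg_cong[OF invertible_matrix_inv(1)[OF assms], of ctranspose]
  by (intro matrix_inv_eqI) (simp add: ctranspose_mult)

lemma invertible_ctranspose:
  fixes M :: "complex^'n^'n"
  assumes "invertible M"
  shows "invertible (ctranspose M)"
  using arg_cong[OF invertible_matrix_inv(1)[OF assms], of ctranspose]
  by (auto simp: ctranspose_mult invertible_left_inverse)

section \<open>Continuity of inversion at the identity\<close>

text \<open>In finite dimension bilinearity already gives boundedness. This provides both limits of
  products and a norm estimate for them.\<close>

lemma bounded_bilinear_matrix_mult:
  "bounded_bilinear ((**) :: complex^'n^'m \<Rightarrow> complex^'p^'n \<Rightarrow> complex^'p^'m)"
  unfolding bilinear_conv_bounded_bilinear[symmetric] bilinear_def linear_iff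
  by (auto simp: matrix_add_ldistrib matrix_add_rdistrib matrix_scalar_ac scalar_matrix_assoc)

lemma tendsto_det:
  fixes f :: "'b \<Rightarrow> 'a::real_normed_field^'n^'n"
  assumes "(f \<longlongrightarrow> M) F"
  shows "((\<lambda>x. det (f x)) \<longlongrightarrow> det M) F"
  unfolding det_def by (intro tendsto_intros assms)

lemma eventually_invertible_near_1:
  fixes f :: "'b \<Rightarrow> 'a::real_normed_field^'n^'n"
  assumes "(f \<longlongrightarrow> mat 1) F"
  shows "\<forall>\<^sub>F x in F. invertible (f x)"
proof -
  have "\<forall>\<^sub>F x in F. det (f x) \<noteq> 0"
    using tendsto_imp_eventually_ne[OF tendsto_det[OF assms], of 0] by simp
  then show ?thesis
    by (simp add: invertible_det_nz)
qed

lemma tendsto_matrix_inv_1: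
  fixes f :: "'b \<Rightarrow> complex^'n^'n"
  assumes f: "(f \<longlongrightarrow> mat 1) F"
  shows "((\<lambda>x. matrix_inv (f x)) \<longlongrightarrow> mat 1) F"
proof -
  obtain K where K: "K > 0" "\<And>(M :: complex^'n^'n) (N :: complex^'n^'n). norm (M ** N) \<le> norm M * norm N * K"
    using bounded_bilinear.pos_bounded[OF bounded_bilinear_matrix_mult] by blast
  have lim: "((\<lambda>x. norm (mat 1 - f x)) \<longlongrightarrow> 0) F"
    using tendsto_norm[OF tendsto_diff[OF tendsto_const f, of "mat 1"]] by simp
  \<comment> \<open>The threshold makes \<open>norm E * K\<close> at most 1/2 below, so that the
    term in \<open>norm D\<close> on the right can be absorbed on the left.\<close>
  have "\<forall>\<^sub>F x in F. norm (mat 1 - f x) < 1 / (2 * K)"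
    using order_tendstoD(2)[OF lim, of "1 / (2 * K)"] K(1) by simp
  then have "\<forall>\<^sub>F x in F. norm (matrix_inv (f x) - mat 1) \<le> 2 * norm (mat 1 - f x)"
    using eventually_invertible_near_1[OF f]
  proof eventually_elim
    case (elim x)
    define E where "E = mat 1 - f x"
    define D where "D = matrix_inv (f x) - mat 1"
    \<comment> \<open>Multiplying \<open>D\<close> by \<open>f x = mat 1 - E\<close> from the left
      gives \<open>E\<close>.\<close>
    have "D = E + E ** D"
      by (simp add: D_def E_def matrix_diff_ldistrib matrix_diff_rdistrib
          invertible_matrix_inv(1)[OF elim(2)])
    then have "norm D \<le> norm E + norm (E ** D)"
      by (metis norm_triangle_ineq)
    also have "\<dots> \<le> norm E + (norm E * K) * norm D"
      using K(2)[of E D] by (simp add: mult_ac)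
    also have "(norm E * K) * norm D \<le> 1/2 * norm D"
      using elim(1) K(1) by (intro mult_right_mono) (auto simp: E_def field_simps)
    finally show ?case
      by (simp add: D_def E_def)
  qed
  moreover have "((\<lambda>x. 2 * norm (mat 1 - f x)) \<longlongrightarrow> 0) F"
    using tendsto_mult_right_zero[OF lim] .
  ultimately have "((\<lambda>x. matrix_inv (f x) - mat 1) \<longlongrightarrow> 0) F"
    by (rule Lim_null_comparison)
  then show ?thesis
    by (rule LIM_zero_cancel)
qed

section \<open>Ranges, rank and index\<close>

lemma mat_range_mult: "mat_range (M ** N) = (*v) M ` mat_range N"
  by (auto simp: mat_range_def image_image matrix_vector_mul_assoc)

lemma mat_range_mult_subset: "mat_range (M ** N) \<subseteq> mat_range M"
  by (auto simp: mat_range_mult) (simp add: mat_range_def)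

text \<open>Column \<open>j\<close> of \<open>Y\<close> is a preimage under \<open>N\<close> of
  column \<open>j\<close> of \<open>M\<close>. Range inclusions thereby become matrix
  equations.\<close>

lemma factor_through_mat_range:
  assumes "mat_range M \<subseteq> mat_range N"
  obtains Y where "M = N ** Y"
proof -
  have "\<forall>j. \<exists>y. M *v axis j 1 = N *v y"
    using assms by (auto simp: mat_range_def)
  then obtain y where y: "M *v axis j 1 = N *v y j" for j
    by metis
  have "M = N ** (\<chi> i j. y j $ i)"
  proof -
    have "M $ i $ j = (M *v axis j 1) $ i" for i j
      by (simp add: matrix_vector_mult_def axis_def if_distrib cong: if_cong)
    then show ?thesis
      by (simp add: vec_eq_iff y) (simp add: matrix_vector_mult_def matrix_matrix_mult_def)
  qed
  then show ?thesis
    using that by blast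
qed

lemma subspace_mat_range: "vec.subspace (mat_range M)"
  unfolding mat_range_def by (rule vec.subspace_image) simp

text \<open>\<open>rank\<close> is the dimension of the span of the rows. These are the columns of
  the transpose, and the columns of a matrix span its range.\<close>

lemma rank_eq_dim_mat_range_transpose:
  fixes M :: "complex^'n^'m"
  shows "rank M = vec.dim (mat_range (transpose M))"
proof -
  have "columns N \<subseteq> mat_range N" for N :: "complex^'k^'l"
  proof
    fix c assume "c \<in> columns N"
    then obtain j where "c = column j N"
      by (auto simp: columns_def)
    then have "c = N *v axis j 1"
      by (simp add: vec_eq_iff column_def matrix_vector_mult_def axis_def if_distrib cong: if_cong)
    then show "c \<in> mat_range N"
      by (simp add: mat_range_def)
  qed
  moreover have "mat_range N \<subseteq> vec.span (columns N)" for N :: "complex^'k^'l"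
    by (auto simp: mat_range_def matrix_vector_mult_in_columnspace_gen)
  ultimately have "vec.dim (columns N) = vec.dim (mat_range N)" for N :: "complex^'k^'l"
    by (meson order_antisym vec.dim_mono vec.dim_subset)
  then show ?thesis
    by (metis columns_transpose row_rank_def_gen)
qed

lemma rank_mult_le:
  fixes M :: "complex^'n^'m" and N :: "complex^'p^'n"
  shows "rank (M ** N) \<le> rank N"
  by (simp add: rank_eq_dim_mat_range_transpose matrix_transpose_mul vec.dim_subset
      mat_range_mult_subset)

text \<open>The range of \<open>C ** C\<close> is a subspace of the range of \<open>C\<close>; equal
  dimensions force equality, and \<open>C\<close> then factors through its square.\<close>

lemma square_rank_right_factor:
  fixes C :: "complex^'n^'n"
  assumes "vec.dim (mat_range (C ** C)) = vec.dim (mat_range C)"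
  obtains Y where "C = C ** C ** Y"
proof -
  have "mat_range (C ** C) = mat_range C"
    by (intro vec.subspace_dim_equal subspace_mat_range mat_range_mult_subset) (simp add: assms)
  then show ?thesis
    using factor_through_mat_range[of C "C ** C"] that by auto
qed

text \<open>The hypothesis says that \<open>C\<close> is injective on its own range, so applying
  \<open>C\<close> once more preserves the dimension of that range.\<close>

lemma kernel_square_right_factor:
  fixes C :: "complex^'n^'n"
  assumes "\<And>v. C *v (C *v v) = 0 \<Longrightarrow> C *v v = 0"
  obtains Y where "C = C ** C ** Y"
proof -
  have "inj_on ((*v) C) (mat_range C)"
  proof (rule inj_onI)
    fix x y assume "x \<in> mat_range C" "y \<in> mat_range C" and eq: "C *v x = C *v y"
    then obtain u w where uw: "x = C *v u" "y = C *v w"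
      by (auto simp: mat_range_def)
    then have "C *v (C *v (u - w)) = 0"
      using eq by (simp add: matrix_vector_mult_diff_distrib)
    then have "C *v (u - w) = 0"
      by (rule assms)
    then show "x = y"
      by (simp add: uw matrix_vector_mult_diff_distrib)
  qed
  then have "vec.dim ((*v) C ` mat_range C) = vec.dim (mat_range C)"
    by (intro vec.dim_image_eq matrix_vector_mul_linear_gen)
      (simp add: vec.span_eq_iff[THEN iffD2] subspace_mat_range)
  then show ?thesis
    using square_rank_right_factor that by (metis mat_range_mult)
qed

lemma mat_ind_1_rank:
  assumes "mat_ind A = 1"
  shows "rank (A ** A) = rank A"
proof -
  \<comment> \<open>The \<open>LEAST\<close> in \<open>mat_ind\<close> satisfies its defining
    equation once some \<open>k\<close> does. Otherwise the ranks of the powers would drop strictly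
    at every step, which natural numbers cannot do forever.\<close>
  have "\<exists>k. rank (mat_pow A k) = rank (mat_pow A (Suc k))"
  proof (rule ccontr)
    assume neq: "\<not> ?thesis"
    have less: "rank (mat_pow A (Suc k)) < rank (mat_pow A k)" for k
      using neq rank_mult_le[of A "mat_pow A k"] by (metis le_neq_implies_less mat_pow.simps(2))
    have "rank (mat_pow A k) + k \<le> rank (mat_pow A 0)" for k
    proof (induction k)
      case (Suc k)
      then show ?case
        using less[of k] by linarith
    qed simp
    from this[of "Suc (rank (mat_pow A 0))"] show False
      by linarith
  qed
  then have "rank (mat_pow A (mat_ind A)) = rank (mat_pow A (Suc (mat_ind A)))"
    unfolding mat_ind_def by (rule LeastI_ex)
  then show ?thesis
    by (simp add: assms)
qed

section \<open>The group inverse\<close>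

definition is_group_inverse :: "complex^'n^'n \<Rightarrow> complex^'n^'n \<Rightarrow> bool"
  where "is_group_inverse A D \<longleftrightarrow> A ** D = D ** A \<and> A ** D ** A = A \<and> D ** A ** D = D"

lemma is_group_inverseD:
  assumes "is_group_inverse A D"
  shows "A ** D = D ** A" and "A ** D ** A = A" and "D ** A ** A = A" and "A ** D ** D = D"
  using assms by (auto simp: is_group_inverse_def)

text \<open>Since \<open>C ** Y = Z ** C ** C ** Y = Z ** C\<close>, the witness
  \<open>Z ** C ** Y\<close> equals both \<open>C ** Y ** Y\<close> and \<open>Z ** Z ** C\<close>.
  The first form yields \<open>C ** D = C ** Y\<close>, the second \<open>D ** C = Z ** C\<close>,
  and these products agree.\<close>

lemma group_inverse_exists:
  assumes Y: "C = C ** C ** Y" and Z: "C = Z ** C ** C"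
  obtains D where "is_group_inverse C D"
proof -
  note assoc = matrix_mul_assoc[symmetric]
  have CY: "C ** Y = Z ** C"
    using Y Z by (metis matrix_mul_assoc)
  define D where "D = Z ** C ** Y"
  have CD: "C ** D = C ** Y"
    unfolding D_def CY[symmetric] using Y by (simp add: matrix_mul_assoc)
  have DC: "D ** C = Z ** C"
  proof -
    have "D ** C = Z ** (Z ** C) ** C"
      by (simp add: D_def assoc CY)
    then show ?thesis
      using Z by (metis matrix_mul_assoc)
  qed
  have "D ** C ** D = D"
  proof -
    have "D ** C ** D = Z ** (C ** D)"
      unfolding DC by (rule assoc)
    then show ?thesis
      unfolding CD unfolding D_def by (simp add: assoc)
  qed
  moreover have "C ** D ** C = C"
    using Z by (simp add: CD CY)
  ultimately show ?thesis
    using that CD DC CY unfolding is_group_inverse_def by metis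
qed

lemma mat_ind_1_group_inverse:
  assumes "mat_ind A = 1"
  obtains D where "is_group_inverse A D"
proof -
  \<comment> \<open>As \<open>rank\<close> is read off the transpose, the rank condition first
    yields a left factor \<open>Z\<close> of \<open>A ** A\<close>. That factor shows that
    \<open>A\<close> and \<open>A ** A\<close> have the same kernel, which supplies the right
    factor.\<close>
  have "vec.dim (mat_range (transpose A ** transpose A)) = vec.dim (mat_range (transpose A))"
    using mat_ind_1_rank[OF assms]
    by (simp add: rank_eq_dim_mat_range_transpose matrix_transpose_mul)
  then obtain W where W: "transpose A = transpose A ** transpose A ** W"
    by (rule square_rank_right_factor)
  have Z: "A = transpose W ** A ** A"
    using arg_cong[OF W, of transpose] by (simp add: matrix_transpose_mul matrix_mul_assoc)
  have "A *v v = 0" if "A *v (A *v v) = 0" for v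
  proof -
    have "A *v v = transpose W *v (A *v (A *v v))"
      using Z by (simp add: matrix_vector_mul_assoc matrix_mul_assoc)
    then show ?thesis
      by (simp add: that)
  qed
  then obtain Y where "A = A ** A ** Y"
    using kernel_square_right_factor by blast
  then show ?thesis
    using group_inverse_exists Z that by blast
qed

lemma is_group_inverse_ctranspose:
  assumes "is_group_inverse A D"
  shows "is_group_inverse (ctranspose A) (ctranspose D)"
  using assms unfolding is_group_inverse_def by (metis ctranspose_mult matrix_mul_assoc)

text \<open>The kernel condition gives a factorisation through the square on one side; its conjugate
  transpose is the one on the other side.\<close>

lemma hermitian_group_inverse:
  assumes T: "ctranspose T = T"
  obtains D where "is_group_inverse T D"
proof -
  obtain Y where Y: "T = T ** T ** Y"
    using kernel_square_right_factor[of T] hermitian_square_kernel[OF T] by blast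
  have "T = ctranspose Y ** T ** T"
    using arg_cong[OF Y, of ctranspose] by (simp add: ctranspose_mult T matrix_mul_assoc)
  then show ?thesis
    using group_inverse_exists Y that by blast
qed

section \<open>Orthogonal projectors and core inverses\<close>

lemma is_orth_projector_absorb:
  assumes "is_orth_projector P S" "mat_range M \<subseteq> S"
  shows "P ** M = M"
proof -
  obtain Y where "M = P ** Y"
    using assms factor_through_mat_range[of M P] by (auto simp: is_orth_projector_def)
  then show ?thesis
    using assms(1) by (simp add: is_orth_projector_def matrix_mul_assoc)
qed

text \<open>Each projector fixes the other, so \<open>P ** Q = Q\<close> and
  \<open>Q ** P = P\<close>; these two products are adjoint to each other.\<close>

lemma is_orth_projector_unique:
  assumes "is_orth_projector P S" "is_orth_projector Q S"
  shows "P = Q"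
proof -
  have "P ** Q = Q" "Q ** P = P"
    using assms is_orth_projector_absorb by (auto simp: is_orth_projector_def)
  moreover have "ctranspose (P ** Q) = Q ** P"
    using assms by (simp add: ctranspose_mult is_orth_projector_def)
  ultimately show ?thesis
    using assms by (simp add: is_orth_projector_def)
qed

lemma gram_pseudoinverse:
  fixes A :: "complex^'n^'n"
  obtains H where "is_group_inverse (A ** ctranspose A) H"
    and "is_orth_projector (A ** ctranspose A ** H) (mat_range A)"
proof -
  define T where "T = A ** ctranspose A"
  have T: "ctranspose T = T"
    by (simp add: T_def ctranspose_mult)
  obtain H where H: "is_group_inverse T H"
    using hermitian_group_inverse[OF T] by blast
  define P where "P = T ** H"
  have PT: "P ** T = T"
    using is_group_inverseD(2)[OF H] by (simp add: P_def)
  \<comment> \<open>From \<open>ctranspose P ** T = T\<close>, multiplication by \<open>H\<close> on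
    the right gives \<open>ctranspose P ** P = P\<close>, whose left side is visibly
    hermitian.\<close>
  have "ctranspose P ** T = ctranspose (T ** P)"
    by (simp add: ctranspose_mult T)
  also have "T ** P = T"
    using is_group_inverseD(1,2)[OF H] by (simp add: P_def matrix_mul_assoc)
  finally have "ctranspose P ** P = P"
    by (simp add: P_def T matrix_mul_assoc)
  then have herm: "ctranspose P = P"
    by (metis ctranspose_ctranspose ctranspose_mult)
  have "P ** P = P"
    using PT by (simp add: P_def matrix_mul_assoc)
  moreover have "P ** A = A"
  proof -
    \<comment> \<open>The expansion involves \<open>A\<close> only through \<open>T\<close>, and
      \<open>P ** T = T\<close> cancels all its terms.\<close>
    have "(P ** A - A) ** ctranspose (P ** A - A)
        = P ** T ** ctranspose P - P ** T - (T ** ctranspose P - T)"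
      by (simp add: T_def ctranspose_diff ctranspose_mult matrix_diff_ldistrib
          matrix_diff_rdistrib matrix_mul_assoc algebra_simps)
    then have "(P ** A - A) ** ctranspose (P ** A - A) = 0"
      by (simp add: PT)
    then show ?thesis
      using mult_ctranspose_eq_0 by fastforce
  qed
  moreover have "mat_range P \<subseteq> mat_range A"
    using mat_range_mult_subset[of A "ctranspose A ** H"]
    by (simp add: P_def T_def matrix_mul_assoc)
  ultimately have "is_orth_projector P (mat_range A)"
    using herm mat_range_mult_subset[of P A] by (auto simp: is_orth_projector_def)
  then show ?thesis
    using that[of H] H by (simp add: P_def T_def)
qed

text \<open>Existence from \<open>gram_pseudoinverse\<close> together with uniqueness makes the
  definite description denote.\<close>

lemma is_orth_projector_orth_projector:
  fixes A :: "complex^'n^'n"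
  shows "is_orth_projector (orth_projector A) (mat_range A)"
  unfolding orth_projector_def
  using gram_pseudoinverse[of A] is_orth_projector_unique by (metis (no_types, lifting) theI)

lemma orth_projector_mult:
  fixes A :: "complex^'n^'n"
  shows "mat_range M \<subseteq> mat_range A \<Longrightarrow> orth_projector A ** M = M"
  using is_orth_projector_absorb is_orth_projector_orth_projector by blast

lemma ctranspose_orth_projector [simp]:
  fixes A :: "complex^'n^'n"
  shows "ctranspose (orth_projector A) = orth_projector A"
  using is_orth_projector_orth_projector[of A] by (simp add: is_orth_projector_def)

lemma mat_range_orth_projector:
  fixes A :: "complex^'n^'n"
  shows "mat_range (orth_projector A) = mat_range A"
  using is_orth_projector_orth_projector[of A] by (simp add: is_orth_projector_def)

section \<open>The core inverse in terms of a group inverse\<close>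

context
  fixes A D :: "complex^'n^'n"
  assumes D: "is_group_inverse A D"
begin

lemma is_core_inverse_group_inverse: "is_core_inverse A (D ** orth_projector A)"
proof -
  have "A ** (D ** orth_projector A) = orth_projector A"
  proof -
    obtain Y where Y: "orth_projector A = A ** Y"
      using factor_through_mat_range[of "orth_projector A" A] mat_range_orth_projector[of A]
      by auto
    show ?thesis
      by (simp add: Y matrix_mul_assoc is_group_inverseD(2)[OF D])
  qed
  \<comment> \<open>Written this way, \<open>D\<close> has its range in that of \<open>A\<close>,
    and so has every product starting with \<open>D\<close>.\<close>
  moreover have "D = A ** (D ** D)"
    by (simp add: matrix_mul_assoc is_group_inverseD(4)[OF D])
  then have "mat_range (D ** orth_projector A) \<subseteq> mat_range A"
    by (metis mat_range_mult_subset order_trans)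
  ultimately show ?thesis
    by (simp add: is_core_inverse_def)
qed

text \<open>\<open>D ** A\<close> fixes everything in the range of \<open>A\<close>, hence
  \<open>X\<close>; and \<open>A ** X\<close> is prescribed.\<close>

lemma is_core_inverse_unique:
  assumes "is_core_inverse A X"
  shows "X = D ** orth_projector A"
proof -
  obtain Y where Y: "X = A ** Y"
    using assms factor_through_mat_range by (auto simp: is_core_inverse_def)
  have "X = D ** A ** X"
    by (simp add: Y matrix_mul_assoc is_group_inverseD(3)[OF D])
  then show ?thesis
    using assms by (simp add: is_core_inverse_def matrix_mul_assoc[symmetric])
qed

lemma core_inverse_eq: "core_inverse A = D ** orth_projector A"
  unfolding core_inverse_def
  using is_core_inverse_group_inverse is_core_inverse_unique by (intro the_equality)

lemma core_inverse_limit: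
  "(\<forall>\<^sub>F l in at 0. invertible (A ** A ** ctranspose A + mat l)) \<and>
   ((\<lambda>l. A ** ctranspose A ** matrix_inv (A ** A ** ctranspose A + mat l))
      \<longlongrightarrow> core_inverse A) (at 0)"
proof -
  define T where "T = A ** ctranspose A"
  define P where "P = orth_projector A"
  define X where "X = D ** P"
  define B where "B = A ** T"
  obtain H where H: "is_group_inverse T H" and "is_orth_projector (T ** H) (mat_range A)"
    using gram_pseudoinverse[of A] unfolding T_def by blast
  then have TH: "T ** H = P"
    using is_orth_projector_unique is_orth_projector_orth_projector P_def by blast
  have HT: "H ** T = P"
    using H TH by (simp add: is_group_inverse_def)
  have PA: "P ** A = A"
    by (simp add: P_def orth_projector_mult)
  have PB: "P ** B = B"
    by (simp add: B_def matrix_mul_assoc PA)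
  have XP: "X ** P = X"
    by (simp add: X_def P_def matrix_mul_assoc[symmetric] orth_projector_mult
        mat_range_orth_projector)
  have XB: "X ** B = T"
  proof -
    have "X ** B = D ** (P ** A) ** A ** ctranspose A"
      by (simp add: X_def B_def T_def matrix_mul_assoc)
    also have "\<dots> = T"
      by (simp add: PA T_def is_group_inverseD(3)[OF D])
    finally show ?thesis .
  qed
  define G where "G = H ** X"
  have GB: "G ** B = P"
    by (simp add: G_def matrix_mul_assoc[symmetric] XB HT)
  define F where "F l = mat 1 + G ** mat l" for l
  have FB: "F l ** B = P ** (B + mat l)" for l
  proof -
    have "F l ** B = B + G ** (mat l ** B)"
      by (simp add: F_def matrix_add_rdistrib matrix_mul_assoc)
    also have "G ** (mat l ** B) = P ** mat l"
      by (simp add: mat_mult_commute[of l B] matrix_mul_assoc GB)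
    finally show ?thesis
      by (simp add: matrix_add_ldistrib PB)
  qed
  have "((\<lambda>l::complex. mat l :: complex^'n^'n) \<longlongrightarrow> mat 0) (at 0)"
    unfolding mat_def
  proof (intro tendsto_vec_lambda)
    fix i j :: 'n
    show "((\<lambda>l::complex. if i = j then l else 0) \<longlongrightarrow> (if i = j then 0 else 0)) (at 0)"
      by (cases "i = j") (auto intro: tendsto_ident_at)
  qed
  then have "(F \<longlongrightarrow> mat 1 + G ** mat 0) (at 0)"
    unfolding F_def
    by (intro tendsto_add tendsto_const bounded_bilinear.tendsto[OF bounded_bilinear_matrix_mult])
  then have F: "(F \<longlongrightarrow> mat 1) (at 0)"
    by simp
  have "\<forall>\<^sub>F l in at (0::complex). l \<noteq> 0"
    by (simp add: eventually_at_filter)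
  with eventually_invertible_near_1[OF F]
  have ev: "\<forall>\<^sub>F l in at 0. invertible (F l) \<and> invertible (B + mat l)"
  proof eventually_elim
    case (elim l)
    \<comment> \<open>By \<open>FB\<close>, invertibility of \<open>F l\<close> forces
      \<open>B *v v = 0\<close>, which leaves \<open>l *s v = 0\<close> with nonzero
      \<open>l\<close>.\<close>
    have "v = 0" if v: "(B + mat l) *v v = 0" for v
    proof -
      have "F l *v (B *v v) = 0"
        by (simp add: matrix_vector_mul_assoc FB) (simp add: matrix_vector_mul_assoc[symmetric] v)
      then have "B *v v = 0"
        using elim(1) by (metis invertible_left_inverse matrix_left_invertible_ker)
      then have "l *s v = 0"
        using v by (simp add: matrix_vector_mult_add_rdistrib mat_mult_vector)
      then show ?thesis
        using elim(2) by simp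
    qed
    then show ?case
      using elim(1) by (simp add: invertible_left_inverse[of "B + mat l"] matrix_left_invertible_ker)
  qed
  then have eq: "\<forall>\<^sub>F l in at 0. X ** (matrix_inv (F l) ** P) = T ** matrix_inv (B + mat l)"
  proof eventually_elim
    case (elim l)
    \<comment> \<open>Inserting \<open>B + mat l\<close> and its inverse after \<open>P\<close> lets
      \<open>FB\<close> replace \<open>P ** (B + mat l)\<close> by \<open>F l ** B\<close>, whose
      first factor cancels.\<close>
    have "matrix_inv (F l) ** P
        = matrix_inv (F l) ** (P ** (B + mat l)) ** matrix_inv (B + mat l)"
      using elim by (simp add: matrix_mul_assoc[symmetric] invertible_matrix_inv)
    also have "\<dots> = B ** matrix_inv (B + mat l)"
      using elim by (simp add: FB[symmetric] matrix_mul_assoc invertible_matrix_inv)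
    finally show ?case
      by (simp add: matrix_mul_assoc XB)
  qed
  have "((\<lambda>l. X ** (matrix_inv (F l) ** P)) \<longlongrightarrow> X ** (mat 1 ** P)) (at 0)"
    by (intro bounded_bilinear.tendsto[OF bounded_bilinear_matrix_mult] tendsto_const
        tendsto_matrix_inv_1 F)
  then have "((\<lambda>l. X ** (matrix_inv (F l) ** P)) \<longlongrightarrow> X) (at 0)"
    by (simp only: matrix_mul_lid XP)
  then have "((\<lambda>l. T ** matrix_inv (B + mat l)) \<longlongrightarrow> X) (at 0)"
    using eq by (rule Lim_transform_eventually)
  moreover have "\<forall>\<^sub>F l in at 0. invertible (B + mat l)"
    using ev by eventually_elim simp
  ultimately show ?thesis
    by (simp add: core_inverse_eq X_def P_def B_def T_def matrix_mul_assoc)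
qed

end

text \<open>Conjugate transposition carries the first and third conditions of
  \<open>is_dual_core_inverse\<close> to the two conditions of \<open>is_core_inverse\<close> for
  the adjoint matrix.\<close>

lemma dual_core_inverse_eq:
  assumes "is_group_inverse (ctranspose A) D"
  shows "dual_core_inverse A = ctranspose (core_inverse (ctranspose A))"
proof -
  define C where "C = ctranspose A"
  note D = assms[folded C_def]
  define X where "X = D ** orth_projector C"
  have core: "is_core_inverse C X"
    using is_core_inverse_group_inverse[OF D] by (simp add: X_def)
  \<comment> \<open>This yields the remaining range condition, the one on
    \<open>ctranspose X\<close> itself.\<close>
  have "X ** orth_projector C = X"
    by (simp add: X_def matrix_mul_assoc[symmetric] orth_projector_mult mat_range_orth_projector)
  then have "ctranspose X = orth_projector C ** ctranspose X"
    by (metis ctranspose_mult ctranspose_orth_projector)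
  then have "mat_range (ctranspose X) \<subseteq> mat_range C"
    by (metis mat_range_mult_subset mat_range_orth_projector)
  moreover have "ctranspose X ** A = ctranspose (C ** X)"
    by (simp add: ctranspose_mult C_def)
  ultimately have "is_dual_core_inverse A (ctranspose X)"
    using core by (simp add: is_dual_core_inverse_def is_core_inverse_def C_def[symmetric])
  moreover have "Z = ctranspose X" if "is_dual_core_inverse A Z" for Z
  proof -
    have "C ** ctranspose Z = ctranspose (Z ** A)"
      by (simp add: ctranspose_mult C_def)
    then have "is_core_inverse C (ctranspose Z)"
      using that by (simp add: is_dual_core_inverse_def is_core_inverse_def C_def[symmetric])
    then show ?thesis
      using is_core_inverse_unique[OF D] X_def by (metis ctranspose_ctranspose)
  qed
  ultimately have "dual_core_inverse A = ctranspose X"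
    unfolding dual_core_inverse_def by (intro the_equality)
  then show ?thesis
    using core_inverse_eq[OF D] by (simp add: X_def C_def)
qed

theorem corollary4p2:
  fixes A :: "complex^'n^'n"
  assumes "\<not> nilpotent_mat A"
    and "mat_ind A = 1"
  shows
    "(\<forall>\<^sub>F l in at (0::complex). invertible (A ** A ** ctranspose A + mat l)) \<and>
     ((\<lambda>l::complex. A ** ctranspose A ** matrix_inv (A ** A ** ctranspose A + mat l))
        \<longlongrightarrow> core_inverse A) (at 0) \<and>
     (\<forall>\<^sub>F l in at (0::complex). invertible (ctranspose A ** A ** A + mat l)) \<and>
     ((\<lambda>l::complex. matrix_inv (ctranspose A ** A ** A + mat l) ** ctranspose A ** A)
        \<longlongrightarrow> dual_core_inverse A) (at 0)"
proof -
  obtain D where D: "is_group_inverse A D"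
    using mat_ind_1_group_inverse[OF assms(2)] by blast
  define C where "C = ctranspose A"
  have C: "is_group_inverse C (ctranspose D)"
    using is_group_inverse_ctranspose[OF D] by (simp add: C_def)
  define M where "M l = C ** C ** A + mat l" for l
  \<comment> \<open>The adjoint conjugates the scalar, so \<open>M\<close> is taken at
    \<open>cnj l\<close> to arrive at \<open>l\<close>.\<close>
  have adj: "ctranspose (M (cnj l)) = C ** A ** A + mat l" for l
    by (simp add: M_def C_def ctranspose_add ctranspose_mult matrix_mul_assoc)
  have inv: "\<forall>\<^sub>F l in at 0. invertible (M l)"
    and lim: "((\<lambda>l. C ** A ** matrix_inv (M l)) \<longlongrightarrow> core_inverse C) (at 0)"
    using core_inverse_limit[OF C] by (simp_all add: M_def C_def)
  \<comment> \<open>Conjugation maps punctured neighbourhoods of 0 into such neighbourhoods, so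
    \<open>inv\<close> and \<open>lim\<close> survive the substitution of \<open>cnj l\<close> for
    \<open>l\<close>.\<close>
  have cnj: "filterlim cnj (at 0) (at 0)"
    using tendsto_cnj[OF tendsto_ident_at[of 0 UNIV]]
    by (auto simp: filterlim_at eventually_at_filter)
  have inv': "\<forall>\<^sub>F l in at 0. invertible (M (cnj l))"
    using eventually_compose_filterlim[OF inv cnj] .
  have "((\<lambda>l. ctranspose (C ** A ** matrix_inv (M (cnj l)))) \<longlongrightarrow> ctranspose (core_inverse C)) (at 0)"
    by (intro tendsto_ctranspose filterlim_compose[OF lim cnj])
  then have "((\<lambda>l. ctranspose (C ** A ** matrix_inv (M (cnj l)))) \<longlongrightarrow> dual_core_inverse A) (at 0)"
    using dual_core_inverse_eq[OF C[unfolded C_def]] by (simp add: C_def)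
  moreover have "\<forall>\<^sub>F l in at 0. ctranspose (C ** A ** matrix_inv (M (cnj l)))
      = matrix_inv (C ** A ** A + mat l) ** C ** A"
    using inv'
  proof eventually_elim
    case (elim l)
    show ?case
      using ctranspose_matrix_inv[OF elim]
      by (simp add: ctranspose_mult adj matrix_mul_assoc) (simp add: C_def)
  qed
  ultimately have "((\<lambda>l. matrix_inv (C ** A ** A + mat l) ** C ** A) \<longlongrightarrow> dual_core_inverse A) (at 0)"
    by (rule Lim_transform_eventually)
  moreover have "\<forall>\<^sub>F l in at 0. invertible (C ** A ** A + mat l)"
    using inv' by eventually_elim (metis adj invertible_ctranspose)
  ultimately show ?thesis
    using core_inverse_limit[OF D] by (simp add: C_def)
qed

end
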